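(* Let $\lambda = 1/\mathbb{E}(X)$, where $X=|\mathcal{X}|$ and $\mathbb{E}$ is expectation with respect to $\mathbb{P}$. (a) Suppose that the graph $(K,E)$ is connected. Then there is a unique probability $P_E$ on $(\Omega,\mathcal{F})$ which satisfies (PN), (PI) and (PEI). Moreover $$P_E(F\cap\{S=x\}) = \lambda\, \mathbb{P}(F\cap\{x\in\mathcal{X}\}) \quad\text{for all } F\in\mathcal{F}_W,\ x\in K. \qquad ( * )$$ In particular, for $x\in K$ and $B\subset K$, $$P_E(S=x)=\lambda Q_x,\qquad P_E(\mathcal{X}=B)=\lambda |B| q_B,$$ and if $F\in\mathcal{F}_W$ then $$P_E(F)=\frac{\mathbb{E}(1_F X)}{\mathbb{E}(X)}.$$ (b) The probability $P_E$ on $(\Omega,\mathcal{F})$ defined by $( * )$ satisfies (PN), (PI) and (PEI).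
   Context: Setting. $K$ is a finite set with $|K|=M\ge 1$. $(\Omega_O,\mathcal{F}_O,\mathbb{P}_O)$ is a probability space carrying a random variable $\mathcal{X}^O$ with values in the set of all subsets of $K$, and $\mathbb{P}_O(\mathcal{X}^O=\emptyset)<1$. Let $\partial$ be a point not in $K$, $\Omega_A=K\cup\{\partial\}$, $\Omega=\Omega_O\times\Omega_A$, and $S:\Omega\to\Omega_A$, $S((\omega,x))=x$. Let $\mathcal{F}_W=\{F\times\Omega_A: F\in\mathcal{F}_O\}$ and $\mathcal{F}=\sigma(\mathcal{F}_W,S)$. The probability $\mathbb{P}$ on $(\Omega,\mathcal{F}_W)$ is defined by $\mathbb{P}(F\times\Omega_A)=\mathbb{P}_O(F)$. A random variable $Y^O$ on $\Omega_O$ is extended to $\Omega$ by $Y((\omega,x))=Y^O(\omega)$; thus $\mathcal{X}$ is the extension of $\mathcal{X}^O$. Write $X=|\mathcal{X}|$, $q_B=\mathbb{P}(\mathcal{X}=B)$ for $B\subset K$, and $Q_x=\mathbb{P}(x\in\mathcal{X})$ for $x\in K$. Graph. The graph $(K,E)$ has vertex set $K$, and $\{x,y\}$ is an edge (element of $E$) if $\mathbb{P}(\{x,y\}\subset\mathcal{X})>0$. Principles, for a probability $P_A$ on $(\Omega,\mathcal{F})$: (PN): (i) if $F\in\mathcal{F}_W$ and $\mathbb{P}(F)=0$ then $P_A(F)=0$; (ii) $P_A(S\in\mathcal{X})=1$. (PI): for $x\in K$ and nonempty $B\subset K$ with $P_A(\mathcal{X}=B)>0$, $P_A(S=x\mid\mathcal{X}=B)=|B|^{-1}1_B(x)$.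 (PEI): if $F\in\mathcal{F}_W$, $x\in K$ and $P_A(S=x)>0$, then $P_A(F\mid S=x)=\mathbb{P}(F\mid x\in\mathcal{X})$. *)

theory Defs
  imports "HOL-Probability.Probability"
begin

text \<open>Throughout, \<open>MO\<close> is the probability space carrying the random set \<open>XO\<close>, whose values are
  subsets of the finite set \<open>K\<close>, and \<open>cem\<close> is the extra point outside \<open>K\<close>.\<close>

definition Omega_A :: "'k set \<Rightarrow> 'k \<Rightarrow> 'k set" where
  "Omega_A K cem = insert cem K"

definition Omega :: "'k set \<Rightarrow> 'k \<Rightarrow> 'o measure \<Rightarrow> ('o \<times> 'k) set" where
  "Omega K cem MO = space MO \<times> Omega_A K cem"

definition site :: "'o \<times> 'k \<Rightarrow> 'k" where
  "site w = snd w"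

definition FW :: "'k set \<Rightarrow> 'k \<Rightarrow> 'o measure \<Rightarrow> ('o \<times> 'k) set set" where
  "FW K cem MO = {F \<times> Omega_A K cem | F. F \<in> sets MO}"

text \<open>The finite set \<open>Omega_A K cem\<close> carries its power set as sigma-algebra.\<close>

definition FF :: "'k set \<Rightarrow> 'k \<Rightarrow> 'o measure \<Rightarrow> ('o \<times> 'k) set set" where
  "FF K cem MO = sigma_sets (Omega K cem MO)
     (FW K cem MO \<union> {site -` A \<inter> Omega K cem MO | A. A \<subseteq> Omega_A K cem})"

text \<open>The measure \<open>F \<times> Omega_A K cem \<mapsto> emeasure MO F\<close> on \<open>FW K cem MO\<close>; the set \<open>F\<close> is recovered from
  \<open>F \<times> Omega_A K cem\<close> as its first projection. See \<open>emeasure_world\<close> below.\<close>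

definition world :: "'k set \<Rightarrow> 'k \<Rightarrow> 'o measure \<Rightarrow> ('o \<times> 'k) measure" where
  "world K cem MO = measure_of (Omega K cem MO) (FW K cem MO) (\<lambda>G. emeasure MO (fst ` G))"

definition lift :: "('o \<Rightarrow> 'b) \<Rightarrow> 'o \<times> 'k \<Rightarrow> 'b" where
  "lift Y w = Y (fst w)"

definition edges :: "'k set \<Rightarrow> 'k \<Rightarrow> 'o measure \<Rightarrow> ('o \<Rightarrow> 'k set) \<Rightarrow> 'k set set" where
  "edges K cem MO XO = {{x, y} | x y. x \<in> K \<and> y \<in> K \<and> x \<noteq> y \<and>
     \<P>(w in world K cem MO. {x, y} \<subseteq> lift XO w) > 0}"

definition connected_graph :: "'k set \<Rightarrow> 'k set set \<Rightarrow> bool" where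
  "connected_graph V E \<longleftrightarrow>
     (\<forall>x\<in>V. \<forall>y\<in>V. (x, y) \<in> {(u, v). u \<in> V \<and> v \<in> V \<and> {u, v} \<in> E}\<^sup>*)"

definition prob_on :: "'a set \<Rightarrow> 'a set set \<Rightarrow> 'a measure \<Rightarrow> bool" where
  "prob_on Om F PA \<longleftrightarrow> prob_space PA \<and> space PA = Om \<and> sets PA = F"

definition PN :: "'k set \<Rightarrow> 'k \<Rightarrow> 'o measure \<Rightarrow> ('o \<Rightarrow> 'k set) \<Rightarrow> ('o \<times> 'k) measure \<Rightarrow> bool" where
  "PN K cem MO XO PA \<longleftrightarrow>
     (\<forall>F\<in>FW K cem MO. measure (world K cem MO) F = 0 \<longrightarrow> measure PA F = 0) \<and>
     \<P>(w in PA. site w \<in> lift XO w) = 1"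

definition PI :: "'k set \<Rightarrow> ('o \<Rightarrow> 'k set) \<Rightarrow> ('o \<times> 'k) measure \<Rightarrow> bool" where
  "PI K XO PA \<longleftrightarrow>
     (\<forall>x\<in>K. \<forall>B. B \<subseteq> K \<and> B \<noteq> {} \<and> \<P>(w in PA. lift XO w = B) > 0 \<longrightarrow>
        \<P>(w in PA. site w = x \<bar> lift XO w = B) = inverse (real (card B)) * indicator B x)"

definition PEI :: "'k set \<Rightarrow> 'k \<Rightarrow> 'o measure \<Rightarrow> ('o \<Rightarrow> 'k set) \<Rightarrow> ('o \<times> 'k) measure \<Rightarrow> bool" where
  "PEI K cem MO XO PA \<longleftrightarrow>
     (\<forall>F\<in>FW K cem MO. \<forall>x\<in>K. \<P>(w in PA. site w = x) > 0 \<longrightarrow>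
        \<P>(w in PA. w \<in> F \<bar> site w = x) = \<P>(w in world K cem MO. w \<in> F \<bar> x \<in> lift XO w))"

lemma FW_subset: "FW K cem MO \<subseteq> Pow (Omega K cem MO)"
  by (auto simp: FW_def Omega_def dest: sets.sets_into_space)

lemma sigma_algebra_FW: "sigma_algebra (Omega K cem MO) (FW K cem MO)"
proof (subst sigma_algebra_iff2, intro conjI ballI allI impI)
  show "FW K cem MO \<subseteq> Pow (Omega K cem MO)" by (rule FW_subset)
  show "{} \<in> FW K cem MO" by (force simp: FW_def)
next
  fix G assume "G \<in> FW K cem MO"
  then obtain F where F: "F \<in> sets MO" "G = F \<times> Omega_A K cem" by (auto simp: FW_def)
  have "Omega K cem MO - G = (space MO - F) \<times> Omega_A K cem"
    using F by (auto simp: Omega_def)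
  then show "Omega K cem MO - G \<in> FW K cem MO"
    using F by (auto simp: FW_def)
next
  fix G :: "nat \<Rightarrow> _" assume "range G \<subseteq> FW K cem MO"
  then have "\<forall>i. \<exists>F. F \<in> sets MO \<and> G i = F \<times> Omega_A K cem" by (auto simp: FW_def)
  then obtain F where F: "\<And>i. F i \<in> sets MO" "\<And>i. G i = F i \<times> Omega_A K cem" by metis
  have "(\<Union>i. G i) = (\<Union>i. F i) \<times> Omega_A K cem" using F by auto
  moreover have "(\<Union>i. F i) \<in> sets MO" using F by auto
  ultimately show "(\<Union>i. G i) \<in> FW K cem MO" by (auto simp: FW_def)
qed

lemma space_world: "space (world K cem MO) = Omega K cem MO"
  by (simp add: world_def space_measure_of FW_subset)

lemma sets_world: "sets (world K cem MO) = FW K cem MO"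
  by (simp add: world_def sets_measure_of FW_subset sigma_algebra.sigma_sets_eq sigma_algebra_FW)

lemma fst_times_Omega_A: "fst ` (F \<times> Omega_A K cem) = F"
  by (auto simp: Omega_A_def)

lemma emeasure_world:
  assumes "F \<in> sets MO"
  shows "emeasure (world K cem MO) (F \<times> Omega_A K cem) = emeasure MO F"
proof -
  let ?mu = "\<lambda>G. emeasure MO (fst ` (G :: ('a \<times> 'b) set))"
  have ca: "countably_additive (FW K cem MO) ?mu"
  proof (rule countably_additiveI)
    fix G :: "nat \<Rightarrow> _" assume G: "range G \<subseteq> FW K cem MO" and disj: "disjoint_family G"
    from G have "\<forall>i. \<exists>F. F \<in> sets MO \<and> G i = F \<times> Omega_A K cem" by (auto simp: FW_def)
    then obtain F where F: "\<And>i. F i \<in> sets MO" "\<And>i. G i = F i \<times> Omega_A K cem" by metis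
    have eq: "fst ` G i = F i" for i unfolding F(2) by (rule fst_times_Omega_A)
    have "disjoint_family F"
      using disj by (auto simp: disjoint_family_on_def F(2) Omega_A_def)
    then have "(\<Sum>i. emeasure MO (F i)) = emeasure MO (\<Union>i. F i)"
      using F by (intro suminf_emeasure) auto
    then show "(\<Sum>i. ?mu (G i)) = ?mu (\<Union>i. G i)"
      by (simp add: eq image_UN)
  qed
  have "emeasure (world K cem MO) (F \<times> Omega_A K cem) = ?mu (F \<times> Omega_A K cem)"
    unfolding world_def using assms
    by (intro emeasure_measure_of_sigma sigma_algebra_FW ca)
       (auto simp: positive_def FW_def)
  then show ?thesis unfolding fst_times_Omega_A .
qed

lemma measure_world:
  "F \<in> sets MO \<Longrightarrow> measure (world K cem MO) (F \<times> Omega_A K cem) = measure MO F"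
  by (simp add: measure_def emeasure_world)

lemma prob_space_world:
  assumes "prob_space MO"
  shows "prob_space (world K cem MO)"
proof (rule prob_spaceI)
  show "emeasure (world K cem MO) (space (world K cem MO)) = 1"
    using emeasure_world[of "space MO" MO K cem] prob_space.emeasure_space_1[OF assms]
    by (simp add: space_world Omega_def)
qed

end

theory Submission
  imports Defs
begin

text \<open>
  Under (PEI) a law on the extended space is already known up to one number per site: the events
  of \<open>MO\<close>, seen from site \<open>x\<close>, have the weight \<open>c x\<close> times their probability jointly with
  \<open>x \<in> XO\<close> (\<open>PEI_imp_site_weights\<close>). If two sites \<open>x\<close>, \<open>y\<close> span an edge, some value \<open>B\<close> of the
  random set contains both and has positive probability; (PI) makes \<open>x\<close> and \<open>y\<close> equally
  likely given \<open>B\<close>, and this says \<open>c x = c y\<close> (\<open>PI_weights_eq_on_edge\<close>). On a connected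
  graph \<open>c\<close> is therefore constant. By (PN) the site lies in \<open>K\<close> almost surely, so the site
  probabilities \<open>c x * Q x\<close> sum to one, where \<open>Q x\<close> is the probability of \<open>x \<in> XO\<close>;
  since \<open>\<Sum>x\<in>K. Q x\<close> is the mean size of the random set,
  the constant is the inverse of that mean (\<open>principles_imp_size_biased\<close>).

  What remains concerns the size-biased law, the one with this constant weight. Every event of the
  extended sigma-algebra is a finite union of slices, one per site, and each slice is cut out by an
  event of \<open>MO\<close>; hence the weights determine the law (\<open>size_biased_unique\<close>). The law exists
  because it has an explicit density with respect to the product of \<open>MO\<close> and counting
  measure, namely the indicator of \<open>site \<in> XO\<close> divided by the mean size
  (\<open>size_biased_exists\<close>). It satisfies the three principles by direct computation from the
  weights.
\<close>

section \<open>Events of the extended sigma-algebra\<close>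

text \<open>Recognising the extended sigma-algebra as a product sigma-algebra makes measurability of
  sections and the product measure available.\<close>

lemma sets_pair_count_space_eq_FF:
  "sets (MO \<Otimes>\<^sub>M count_space (Omega_A K cem)) = FF K cem MO"
proof -
  let ?A = "Omega_A K cem" and ?Om = "Omega K cem MO"
  let ?G = "FW K cem MO \<union> {site -` A \<inter> ?Om | A. A \<subseteq> ?A}"
  let ?R = "{a \<times> b | a b. a \<in> sets MO \<and> b \<in> sets (count_space ?A)}"
  interpret G: sigma_algebra ?Om "sigma_sets ?Om ?G"
    using FW_subset[of K cem MO] by (intro sigma_algebra_sigma_sets) auto
  have "sigma_sets ?Om ?R = sigma_sets ?Om ?G"
  proof (rule sigma_sets_eqI)
    fix R assume "R \<in> ?R"
    then obtain a b where ab: "R = a \<times> b" "a \<in> sets MO" "b \<subseteq> ?A" by auto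
    have R: "R = (a \<times> ?A) \<inter> (site -` b \<inter> ?Om)"
      using ab sets.sets_into_space[OF ab(2)] by (auto simp: Omega_def site_def)
    have "a \<times> ?A \<in> ?G" using ab(2) unfolding FW_def by blast
    moreover have "site -` b \<inter> ?Om \<in> ?G" using ab(3) by blast
    ultimately show "R \<in> sigma_sets ?Om ?G"
      unfolding R by (intro G.Int sigma_sets.Basic)
  next
    fix R assume "R \<in> ?G"
    then consider F where "F \<in> sets MO" "R = F \<times> ?A" | A where "A \<subseteq> ?A" "R = site -` A \<inter> ?Om"
      unfolding FW_def by blast
    then show "R \<in> sigma_sets ?Om ?R"
    proof cases
      case 1
      then have "R \<in> ?R" by auto
      then show ?thesis by (rule sigma_sets.Basic)
    next
      case 2
      then have "R = space MO \<times> A" by (auto simp: Omega_def site_def)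
      then have "R \<in> ?R" using 2(1) by auto
      then show ?thesis by (rule sigma_sets.Basic)
    qed
  qed
  then show ?thesis by (simp add: sets_pair_measure FF_def Omega_def)
qed

lemma FF_section:
  assumes "G \<in> FF K cem MO"
  shows "(\<lambda>\<omega>. (\<omega>, x)) -` G \<in> sets MO"
  using assms unfolding sets_pair_count_space_eq_FF[symmetric] by (rule sets_Pair2)

lemma FW_subset_FF: "FW K cem MO \<subseteq> FF K cem MO"
  by (auto simp: FF_def intro: sigma_sets.Basic)

lemma site_event_in_FF: "{w \<in> Omega K cem MO. site w \<in> A} \<in> FF K cem MO"
proof -
  have "{w \<in> Omega K cem MO. site w \<in> A} = site -` (A \<inter> Omega_A K cem) \<inter> Omega K cem MO"
    by (auto simp: Omega_def site_def)
  then show ?thesis unfolding FF_def by (intro sigma_sets.Basic) blast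
qed

lemma lift_event:
  "{w \<in> Omega K cem MO. R (lift Y w)} = {\<omega> \<in> space MO. R (Y \<omega>)} \<times> Omega_A K cem"
  by (auto simp: Omega_def lift_def)

section \<open>Laws with site weights\<close>

locale observed_random_set = prob_space MO
  for MO :: "'o measure" +
  fixes K :: "'k set" and cem :: 'k and XO :: "'o \<Rightarrow> 'k set"
  assumes finite_K: "finite K"
    and cem_notin_K: "cem \<notin> K"
    and XO_measurable: "XO \<in> measurable MO (count_space (Pow K))"
    and XO_nonempty: "\<P>(\<omega> in MO. XO \<omega> = {}) < 1"
begin

abbreviation "Om \<equiv> Omega K cem MO"
abbreviation "W \<equiv> world K cem MO"
abbreviation "hit x \<equiv> {w \<in> Om. x \<in> lift XO w}"
abbreviation "at_site x \<equiv> {w \<in> Om. site w = x}"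
abbreviation "event_prob \<equiv> prob_on Om (FF K cem MO)"
abbreviation "mean_size \<equiv> (\<integral>w. real (card (lift XO w)) \<partial>W)"

text \<open>The weights may depend on the site here because (PEI) alone leaves them free; the
  size-biased law is the case of the constant \<open>1 / mean_size\<close>.\<close>

definition site_weights :: "('k \<Rightarrow> real) \<Rightarrow> ('o \<times> 'k) measure \<Rightarrow> bool" where
  "site_weights c PE \<longleftrightarrow> (\<forall>F\<in>FW K cem MO. \<forall>x\<in>K.
     measure PE (F \<inter> at_site x) = c x * measure W (F \<inter> hit x))"

sublocale W: prob_space W
  by (rule prob_space_world) (rule prob_space_axioms)

lemma XO_event_in_FW: "{w \<in> Om. R (lift XO w)} \<in> FW K cem MO"
proof -
  have "{\<omega> \<in> space MO. R (XO \<omega>)} = XO -` {B. R B} \<inter> space MO" by auto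
  also have "\<dots> = XO -` ({B. R B} \<inter> Pow K) \<inter> space MO"
    using measurable_space[OF XO_measurable] by auto
  also have "\<dots> \<in> sets MO"
    using XO_measurable by (rule measurable_sets) auto
  finally show ?thesis unfolding lift_event by (auto simp: FW_def)
qed

lemma XO_event_in_FF: "{w \<in> Om. R (lift XO w)} \<in> FF K cem MO"
  by (rule subsetD[OF FW_subset_FF XO_event_in_FW[of R]])

lemma lift_XO_subset: "w \<in> Om \<Longrightarrow> lift XO w \<subseteq> K"
  using measurable_space[OF XO_measurable, of "fst w"] by (auto simp: Omega_def lift_def)

lemma site_in_XO_in_FF: "{w \<in> Om. site w \<in> lift XO w} \<in> FF K cem MO"
proof -
  have "{w \<in> Om. site w \<in> lift XO w} = (\<Union>x\<in>K. hit x \<inter> at_site x)"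
    using lift_XO_subset by auto
  moreover have "hit x \<inter> at_site x \<in> sets (MO \<Otimes>\<^sub>M count_space (Omega_A K cem))" for x
    using XO_event_in_FF[of "\<lambda>B. x \<in> B"] site_event_in_FF[of K cem MO "{x}"]
    unfolding sets_pair_count_space_eq_FF[symmetric] by (intro sets.Int) auto
  ultimately show ?thesis
    unfolding sets_pair_count_space_eq_FF[symmetric]
    by (simp only:) (intro sets.finite_UN finite_K)
qed

lemma Om_in_FW: "Om \<in> FW K cem MO"
  using sets.top[of W] by (simp add: sets_world space_world)

lemma FW_Int: "F \<in> FW K cem MO \<Longrightarrow> G \<in> FW K cem MO \<Longrightarrow> F \<inter> G \<in> FW K cem MO"
  unfolding sets_world[symmetric] by (rule sets.Int)

lemma FW_into_Om: "F \<in> FW K cem MO \<Longrightarrow> F \<subseteq> Om"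
  using FW_subset[of K cem MO] by auto

text \<open>The size of the random set is the sum over all sites of the indicators that it contains the
  site. This is what turns size-biased expectations into sums of site weights.\<close>

lemma integral_card_eq_sum_hit:
  assumes "F \<in> FW K cem MO"
  shows "(\<integral>w. indicator F w * real (card (lift XO w)) \<partial>W) = (\<Sum>x\<in>K. measure W (F \<inter> hit x))"
proof -
  have "(\<integral>w. indicator F w * real (card (lift XO w)) \<partial>W)
      = (\<integral>w. (\<Sum>x\<in>K. indicator (F \<inter> hit x) w) \<partial>W)"
  proof (intro Bochner_Integration.integral_cong refl)
    fix w assume w: "w \<in> space W"
    then have "lift XO w \<subseteq> K" by (auto simp: space_world dest: lift_XO_subset)
    then have "real (card (lift XO w)) = (\<Sum>x\<in>K. indicator (lift XO w) x)"
      by (simp add: indicator_def sum.If_cases finite_K Int_absorb1)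
    with w show "indicator F w * real (card (lift XO w)) = (\<Sum>x\<in>K. indicator (F \<inter> hit x) w)"
      by (simp add: sum_distrib_left space_world indicator_def)
  qed
  also have "\<dots> = (\<Sum>x\<in>K. measure W (F \<inter> hit x))"
  proof (subst Bochner_Integration.integral_sum)
    have hit_W: "F \<inter> hit x \<in> sets W" for x
      unfolding sets_world by (rule FW_Int[OF assms XO_event_in_FW])
    show "integrable W (indicator (F \<inter> hit x) :: _ \<Rightarrow> real)" for x
      using hit_W by (auto simp: W.emeasure_finite less_top[symmetric])
    have "(\<integral>w. indicator (F \<inter> hit x) w \<partial>W) = measure W (F \<inter> hit x)" for x
      unfolding Bochner_Integration.integral_indicator
        Int_absorb2[OF sets.sets_into_space[OF hit_W]] ..
    then show "(\<Sum>x\<in>K. \<integral>w. indicator (F \<inter> hit x) w \<partial>W) = (\<Sum>x\<in>K. measure W (F \<inter> hit x))"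
      by (rule sum.cong[OF refl])
  qed
  finally show ?thesis .
qed

lemma mean_size_eq_sum_hit: "mean_size = (\<Sum>x\<in>K. measure W (hit x))"
proof -
  have "mean_size = (\<integral>w. indicator Om w * real (card (lift XO w)) \<partial>W)"
    by (intro Bochner_Integration.integral_cong) (auto simp: space_world)
  also have "\<dots> = (\<Sum>x\<in>K. measure W (hit x))"
    unfolding integral_card_eq_sum_hit[OF Om_in_FW]
    by (auto intro!: sum.cong arg_cong[where f = "measure W"])
  finally show ?thesis .
qed

lemma mean_size_pos: "mean_size > 0"
proof (rule ccontr)
  assume "\<not> mean_size > 0"
  then have "(\<Sum>x\<in>K. measure W (hit x)) = 0"
    unfolding mean_size_eq_sum_hit by (intro antisym sum_nonneg) auto
  then have null: "measure W (hit x) = 0" if "x \<in> K" for x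
    using that finite_K by (subst (asm) sum_nonneg_eq_0_iff) auto
  have hit_sets: "hit x \<in> sets W" for x
    unfolding sets_world by (rule XO_event_in_FW)
  have "{w \<in> Om. lift XO w \<noteq> {}} = (\<Union>x\<in>K. hit x)" using lift_XO_subset by auto
  moreover have "measure W (\<Union>x\<in>K. hit x) \<le> (\<Sum>x\<in>K. measure W (hit x))"
    using hit_sets finite_K by (intro W.finite_measure_subadditive_finite) auto
  ultimately have "measure W {w \<in> space W. lift XO w \<noteq> {}} = 0"
    using null by (simp add: space_world measure_le_0_iff)
  moreover have "{w \<in> space W. lift XO w = {}} \<in> sets W"
    using XO_event_in_FW[of "\<lambda>B. B = {}"] by (simp add: space_world sets_world)
  ultimately have "measure W {w \<in> space W. lift XO w = {}} = 1"
    using W.prob_neg[of "\<lambda>w. lift XO w = {}"] by simp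
  moreover have "measure W {w \<in> space W. lift XO w = {}} = \<P>(\<omega> in MO. XO \<omega> = {})"
  proof -
    have "{\<omega> \<in> space MO. XO \<omega> = {}} = XO -` {{}} \<inter> space MO" by auto
    also have "\<dots> \<in> sets MO" using XO_measurable by (rule measurable_sets) auto
    finally show ?thesis
      unfolding space_world lift_event[where R = "\<lambda>B. B = {}"] by (rule measure_world)
  qed
  ultimately show False using XO_nonempty by simp
qed

lemma measure_eq_sum_sites:
  assumes "event_prob PE" and "G \<in> FF K cem MO"
  shows "measure PE G = (\<Sum>x\<in>Omega_A K cem. measure PE (G \<inter> at_site x))"
proof -
  interpret PE: prob_space PE using assms by (simp add: prob_on_def)
  have sets: "sets PE = FF K cem MO" "space PE = Om" using assms by (simp_all add: prob_on_def)
  have G: "G \<subseteq> Om" using sets.sets_into_space[of G PE] assms by (simp add: sets)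
  have "G = (\<Union>x\<in>Omega_A K cem. G \<inter> at_site x)"
    using G by (auto simp: Omega_def site_def)
  then have "measure PE G = measure PE (\<Union>x\<in>Omega_A K cem. G \<inter> at_site x)" by simp
  also have "\<dots> = (\<Sum>x\<in>Omega_A K cem. measure PE (G \<inter> at_site x))"
  proof (rule PE.finite_measure_finite_Union)
    show "finite (Omega_A K cem)" using finite_K by (simp add: Omega_A_def)
    have "G \<inter> at_site x \<in> sets PE" for x
      using assms(2) site_event_in_FF[of K cem MO "{x}"] unfolding sets(1)[symmetric]
      by (intro sets.Int) auto
    then show "(\<lambda>x. G \<inter> at_site x) ` Omega_A K cem \<subseteq> sets PE" by auto
  qed (auto simp: disjoint_family_on_def)
  finally show ?thesis .
qed

text \<open>Neither (PEI) nor the weights mention the point \<open>cem\<close>; it carries no mass because the sites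
  of \<open>K\<close> already have total probability one.\<close>

lemma measure_cem_eq_0:
  assumes PE: "event_prob PE" and total: "(\<Sum>x\<in>K. measure PE (at_site x)) = 1"
    and G: "G \<in> FF K cem MO"
  shows "measure PE (G \<inter> at_site cem) = 0"
proof -
  interpret PE: prob_space PE using PE by (simp add: prob_on_def)
  have sets: "sets PE = FF K cem MO" "space PE = Om" using PE by (simp_all add: prob_on_def)
  have Om: "Om \<in> FF K cem MO" using Om_in_FW FW_subset_FF by (rule subsetD[rotated])
  have "1 = (\<Sum>x\<in>Omega_A K cem. measure PE (at_site x))"
    using measure_eq_sum_sites[OF PE Om] PE.prob_space by (simp add: sets Int_def conj_ac)
  also have "\<dots> = measure PE (at_site cem) + 1"
    using finite_K cem_notin_K total by (simp add: Omega_A_def)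
  finally have "measure PE (at_site cem) = 0" by simp
  moreover have "measure PE (G \<inter> at_site cem) \<le> measure PE (at_site cem)"
    using site_event_in_FF[of K cem MO "{cem}"] by (intro PE.finite_measure_mono) (auto simp: sets)
  ultimately show ?thesis by (simp add: measure_le_0_iff)
qed

lemma site_weights_at_site:
  assumes "site_weights c PE" and "x \<in> K"
  shows "measure PE (at_site x) = c x * measure W (hit x)"
proof -
  have "Om \<inter> at_site x = at_site x" "Om \<inter> hit x = hit x" by auto
  then show ?thesis
    using assms(1)[unfolded site_weights_def, rule_format, OF Om_in_FW assms(2)] by simp
qed

section \<open>The size-biased law\<close>

abbreviation "size_biased \<equiv> site_weights (\<lambda>_. 1 / mean_size)"

lemma size_biased_total:
  assumes "size_biased PE"
  shows "(\<Sum>x\<in>K. measure PE (at_site x)) = 1"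
proof -
  have "(\<Sum>x\<in>K. measure PE (at_site x)) = (\<Sum>x\<in>K. 1 / mean_size * measure W (hit x))"
    by (intro sum.cong refl site_weights_at_site[OF assms])
  also have "\<dots> = 1 / mean_size * mean_size"
    unfolding sum_distrib_left[symmetric] mean_size_eq_sum_hit ..
  finally show ?thesis using mean_size_pos by simp
qed

lemma size_biased_measure_FF:
  assumes PE: "event_prob PE" "size_biased PE" and G: "G \<in> FF K cem MO"
  shows "measure PE G = (\<Sum>x\<in>K. measure PE (G \<inter> at_site x))"
proof -
  have "measure PE G = measure PE (G \<inter> at_site cem) + (\<Sum>x\<in>K. measure PE (G \<inter> at_site x))"
    using measure_eq_sum_sites[OF PE(1) G]
    unfolding Omega_A_def sum.insert[OF finite_K cem_notin_K] .
  also have "measure PE (G \<inter> at_site cem) = 0"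
    by (rule measure_cem_eq_0[OF PE(1) size_biased_total[OF PE(2)] G])
  finally show ?thesis by (simp only: add_0_left)
qed

text \<open>On the slice over a site \<open>x\<close>, an arbitrary event agrees with the cylinder over its section
  at \<open>x\<close>, and the weights prescribe the measure of cylinders on slices.\<close>

lemma size_biased_unique:
  assumes P1: "event_prob P1" "size_biased P1" and P2: "event_prob P2" "size_biased P2"
  shows "P1 = P2"
proof (rule measure_eqI)
  interpret P1: prob_space P1 using P1 by (simp add: prob_on_def)
  interpret P2: prob_space P2 using P2 by (simp add: prob_on_def)
  show "sets P1 = sets P2" using P1 P2 by (simp add: prob_on_def)
  fix G assume "G \<in> sets P1"
  then have G: "G \<in> FF K cem MO" using P1 by (simp add: prob_on_def)
  have slice: "measure P1 (G \<inter> at_site x) = measure P2 (G \<inter> at_site x)" if x: "x \<in> K" for x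
  proof -
    let ?F = "((\<lambda>\<omega>. (\<omega>, x)) -` G) \<times> Omega_A K cem"
    have F: "?F \<in> FW K cem MO" using FF_section[OF G] by (auto simp: FW_def)
    have "G \<subseteq> Om"
      using \<open>G \<in> sets P1\<close> sets.sets_into_space[of G P1] P1 by (simp add: prob_on_def)
    then have "G \<inter> at_site x = ?F \<inter> at_site x"
      by (auto simp: Omega_def site_def)
    then show ?thesis
      using P1(2)[unfolded site_weights_def, rule_format, OF F x]
        P2(2)[unfolded site_weights_def, rule_format, OF F x] by simp
  qed
  have "measure P1 G = measure P2 G"
    unfolding size_biased_measure_FF[OF P1 G] size_biased_measure_FF[OF P2 G]
    by (intro sum.cong refl slice)
  then show "emeasure P1 G = emeasure P2 G"
    by (simp add: P1.emeasure_eq_measure P2.emeasure_eq_measure)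
qed

text \<open>Restricted to a cylinder and the slice over \<open>x\<close>, the density below integrates over a product
  set with singleton second factor, which counting measure turns into a probability under \<open>MO\<close>.
  The total mass is one because the normalising constant is the mean size.\<close>

lemma size_biased_exists: "\<exists>PE. event_prob PE \<and> size_biased PE"
proof -
  let ?N = "MO \<Otimes>\<^sub>M count_space (Omega_A K cem)"
  let ?A = "{w \<in> Om. site w \<in> lift XO w}"
  define PE where "PE = density ?N (\<lambda>w. ennreal (1 / mean_size) * indicator ?A w)"
  have sets: "sets PE = FF K cem MO" and space: "space PE = Om"
    by (simp_all add: PE_def sets_pair_count_space_eq_FF space_pair_measure Omega_def)
  interpret C: sigma_finite_measure "count_space (Omega_A K cem)"
    using finite_K by (intro sigma_finite_measure_count_space_finite) (simp add: Omega_A_def)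
  have hitA: "?A = (\<Union>x\<in>K. hit x \<inter> at_site x)"
    using lift_XO_subset by auto
  have A: "?A \<in> sets ?N"
    unfolding sets_pair_count_space_eq_FF by (rule site_in_XO_in_FF)
  have slice: "emeasure PE (F \<inter> at_site x) = ennreal (1 / mean_size * measure W (F \<inter> hit x))"
    if F: "F \<in> FW K cem MO" and x: "x \<in> K" for F x
  proof -
    have "F \<inter> at_site x \<in> FF K cem MO"
      using subsetD[OF FW_subset_FF F] site_event_in_FF[of K cem MO "{x}"]
      unfolding sets[symmetric] by (intro sets.Int) simp_all
    then have meas: "F \<inter> at_site x \<in> sets ?N" by (simp add: sets_pair_count_space_eq_FF)
    from FW_Int[OF F XO_event_in_FW[of "\<lambda>B. x \<in> B"]]
    obtain F' where F': "F' \<in> sets MO" "F \<inter> hit x = F' \<times> Omega_A K cem"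
      unfolding FW_def by blast
    have xA: "x \<in> Omega_A K cem" using x by (simp add: Omega_A_def)
    have "?A \<inter> (F \<inter> at_site x) = (F \<inter> hit x) \<inter> at_site x" by auto
    also have "\<dots> = F' \<times> {x}"
      unfolding F'(2) using xA sets.sets_into_space[OF F'(1)] by (auto simp: Omega_def site_def)
    finally have AF: "?A \<inter> (F \<inter> at_site x) = F' \<times> {x}" .
    have "emeasure PE (F \<inter> at_site x)
        = (\<integral>\<^sup>+w. ennreal (1 / mean_size) * indicator (?A \<inter> (F \<inter> at_site x)) w \<partial>?N)"
      unfolding PE_def indicator_inter_arith[of ?A "F \<inter> at_site x"] mult.assoc[symmetric]
      by (intro emeasure_density meas borel_measurable_times_ennreal borel_measurable_const
          borel_measurable_indicator A)
    also have "\<dots> = ennreal (1 / mean_size) * emeasure ?N (F' \<times> {x})"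
      unfolding AF[symmetric] by (intro nn_integral_cmult_indicator sets.Int meas A)
    also have "emeasure ?N (F' \<times> {x}) = emeasure MO F'"
      using F'(1) xA by (subst C.emeasure_pair_measure_Times) auto
    also have "\<dots> = emeasure W (F \<inter> hit x)"
      unfolding F'(2) by (rule emeasure_world[OF F'(1), symmetric])
    finally show ?thesis
      unfolding W.emeasure_eq_measure using mean_size_pos
      by (subst ennreal_mult) simp_all
  qed
  \<comment> \<open>The density vanishes over \<open>cem\<close>, so the slices over \<open>K\<close> carry the whole mass.\<close>
  have "emeasure PE Om = emeasure PE (\<Union>x\<in>K. Om \<inter> at_site x)"
  proof (rule emeasure_eq_AE)
    show "AE w in PE. w \<in> Om \<longleftrightarrow> w \<in> (\<Union>x\<in>K. Om \<inter> at_site x)"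
      unfolding PE_def
    proof (subst AE_density)
      show "(\<lambda>w. ennreal (1 / mean_size) * indicator ?A w) \<in> borel_measurable ?N"
        using A by auto
      show "AE w in ?N. 0 < ennreal (1 / mean_size) * indicator ?A w \<longrightarrow>
          (w \<in> Om) = (w \<in> (\<Union>x\<in>K. Om \<inter> at_site x))"
      proof (rule AE_I2, rule impI)
        fix w assume pos: "0 < ennreal (1 / mean_size) * indicator ?A w"
        have "w \<in> ?A"
        proof (rule ccontr)
          assume "w \<notin> ?A"
          then have zero: "indicator ?A w = (0 :: ennreal)" by (rule indicator_simps(2))
          show False using pos unfolding zero by simp
        qed
        then show "(w \<in> Om) = (w \<in> (\<Union>x\<in>K. Om \<inter> at_site x))"
          unfolding hitA by blast
      qed
    qed
    show "Om \<in> sets PE" using sets.top[of PE] by (simp add: space)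
    have "at_site x \<in> sets PE" for x
      using site_event_in_FF[of K cem MO "{x}"] by (simp add: sets)
    then show "(\<Union>x\<in>K. Om \<inter> at_site x) \<in> sets PE"
      using \<open>Om \<in> sets PE\<close> finite_K by auto
  qed
  also have "\<dots> = (\<Sum>x\<in>K. emeasure PE (Om \<inter> at_site x))"
  proof (rule sum_emeasure[symmetric])
    have "Om \<inter> at_site x = at_site x" for x by auto
    then show "(\<lambda>x. Om \<inter> at_site x) ` K \<subseteq> sets PE"
      using site_event_in_FF[of K cem MO "{x}" for x] by (auto simp: sets)
  qed (auto simp: disjoint_family_on_def finite_K)
  also have "\<dots> = (\<Sum>x\<in>K. ennreal (1 / mean_size * measure W (Om \<inter> hit x)))"
    by (intro sum.cong refl slice Om_in_FW)
  also have "\<dots> = ennreal (\<Sum>x\<in>K. 1 / mean_size * measure W (Om \<inter> hit x))"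
    using mean_size_pos by (intro sum_ennreal) simp
  also have "(\<Sum>x\<in>K. 1 / mean_size * measure W (Om \<inter> hit x)) = 1 / mean_size * mean_size"
    unfolding sum_distrib_left[symmetric] mean_size_eq_sum_hit
    by (auto intro!: arg_cong2[where f = "(*)"] sum.cong arg_cong[where f = "measure W"])
  finally have "emeasure PE (space PE) = 1" using mean_size_pos by (simp add: space)
  then have "event_prob PE" by (auto simp: prob_on_def sets space intro: prob_spaceI)
  moreover have "size_biased PE"
    unfolding site_weights_def
    using slice mean_size_pos by (auto simp: measure_def)
  ultimately show ?thesis by blast
qed

lemma size_biased_measure_FW:
  assumes PE: "event_prob PE" "size_biased PE" and F: "F \<in> FW K cem MO"
  shows "measure PE F = (\<integral>w. indicator F w * real (card (lift XO w)) \<partial>W) / mean_size"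
proof -
  have "F \<in> FF K cem MO" using FW_subset_FF F by (rule subsetD)
  then have "measure PE F = (\<Sum>x\<in>K. measure PE (F \<inter> at_site x))"
    by (rule size_biased_measure_FF[OF PE])
  also have "\<dots> = (\<Sum>x\<in>K. 1 / mean_size * measure W (F \<inter> hit x))"
  proof (rule sum.cong[OF refl])
    fix x assume "x \<in> K"
    then show "measure PE (F \<inter> at_site x) = 1 / mean_size * measure W (F \<inter> hit x)"
      by (rule PE(2)[unfolded site_weights_def, rule_format, OF F])
  qed
  also have "\<dots> = 1 / mean_size * (\<Sum>x\<in>K. measure W (F \<inter> hit x))"
    by (rule sum_distrib_left[symmetric])
  finally show ?thesis
    unfolding integral_card_eq_sum_hit[OF F] by (simp only: times_divide_eq_left mult_1_left)
qed

lemma size_biased_measure_XO_eq: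
  assumes PE: "event_prob PE" "size_biased PE"
  shows "measure PE {w \<in> Om. lift XO w = B}
    = 1 / mean_size * real (card B) * measure W {w \<in> Om. lift XO w = B}"
proof -
  let ?F = "{w \<in> Om. lift XO w = B}"
  have F: "?F \<in> FW K cem MO" by (rule XO_event_in_FW[of "\<lambda>C. C = B"])
  have "(\<integral>w. indicator ?F w * real (card (lift XO w)) \<partial>W)
      = (\<integral>w. real (card B) * indicator ?F w \<partial>W)"
    by (intro Bochner_Integration.integral_cong refl) (simp split: split_indicator)
  also have "\<dots> = real (card B) * (\<integral>w. indicator ?F w \<partial>W)"
    by (rule integral_mult_right_zero)
  also have "(\<integral>w. indicator ?F w \<partial>W) = measure W ?F"
    unfolding Bochner_Integration.integral_indicator space_world Int_absorb2[OF FW_into_Om[OF F]] ..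
  finally show ?thesis using size_biased_measure_FW[OF PE F] by simp
qed

lemma size_biased_PN:
  assumes PE: "event_prob PE" "size_biased PE"
  shows "PN K cem MO XO PE"
  unfolding PN_def
proof (intro conjI ballI impI)
  fix F assume F: "F \<in> FW K cem MO" and null: "measure W F = 0"
  have "measure W (F \<inter> hit x) = 0" for x
  proof -
    have "measure W (F \<inter> hit x) \<le> measure W F"
      using F by (intro W.finite_measure_mono) (auto simp: sets_world)
    then show ?thesis using null by (simp add: measure_le_0_iff)
  qed
  then show "measure PE F = 0"
    using size_biased_measure_FW[OF PE F] by (simp add: integral_card_eq_sum_hit[OF F])
next
  have sets: "sets PE = FF K cem MO" "space PE = Om" using PE by (simp_all add: prob_on_def)
  let ?A = "{w \<in> Om. site w \<in> lift XO w}"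
  have A: "?A \<in> FF K cem MO" by (rule site_in_XO_in_FF)
  have "measure PE ?A = (\<Sum>x\<in>K. measure PE (?A \<inter> at_site x))"
    by (rule size_biased_measure_FF[OF PE A])
  also have "\<dots> = (\<Sum>x\<in>K. measure PE (at_site x))"
  proof (intro sum.cong refl)
    fix x assume x: "x \<in> K"
    have "?A \<inter> at_site x = hit x \<inter> at_site x" by auto
    moreover have "measure PE (hit x \<inter> at_site x) = 1 / mean_size * measure W (hit x \<inter> hit x)"
      using PE(2) XO_event_in_FW x unfolding site_weights_def by blast
    ultimately show "measure PE (?A \<inter> at_site x) = measure PE (at_site x)"
      using site_weights_at_site[OF PE(2) x] by simp
  qed
  finally show "\<P>(w in PE. site w \<in> lift XO w) = 1"
    using size_biased_total[OF PE(2)] by (simp add: sets)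
qed

lemma size_biased_PI:
  assumes PE: "event_prob PE" "size_biased PE"
  shows "PI K XO PE"
  unfolding PI_def
proof (intro ballI allI impI, elim conjE)
  have space: "space PE = Om" using PE by (simp add: prob_on_def)
  fix x B assume x: "x \<in> K" and B: "B \<subseteq> K" "B \<noteq> {}" and pos: "\<P>(w in PE. lift XO w = B) > 0"
  let ?F = "{w \<in> Om. lift XO w = B}"
  have "measure PE (?F \<inter> at_site x) = 1 / mean_size * measure W (?F \<inter> hit x)"
    using PE(2) XO_event_in_FW[of "\<lambda>C. C = B"] x unfolding site_weights_def by blast
  also have "measure W (?F \<inter> hit x) = indicator B x * measure W ?F"
  proof (cases "x \<in> B")
    case True
    then have "?F \<inter> hit x = ?F" by auto
    with True show ?thesis by simp
  next
    case False
    then have "?F \<inter> hit x = {}" by auto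
    with False show ?thesis by simp
  qed
  finally have num: "measure PE (?F \<inter> at_site x) = 1 / mean_size * (indicator B x * measure W ?F)" .
  have eq: "{w \<in> Om. site w = x \<and> lift XO w = B} = ?F \<inter> at_site x" by auto
  have "card B > 0" using B finite_K finite_subset card_gt_0_iff by blast
  moreover have "measure W ?F > 0"
    using pos size_biased_measure_XO_eq[OF PE, of B] measure_nonneg[of W ?F]
    by (cases "measure W ?F = 0") (simp add: space, linarith)
  ultimately show "\<P>(w in PE. site w = x \<bar> lift XO w = B) = inverse (real (card B)) * indicator B x"
    unfolding cond_prob_def space eq num size_biased_measure_XO_eq[OF PE]
    using mean_size_pos by (simp add: field_simps)
qed

lemma size_biased_PEI:
  assumes PE: "event_prob PE" "size_biased PE"
  shows "PEI K cem MO XO PE"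
  unfolding PEI_def
proof (intro ballI impI)
  have space: "space PE = Om" using PE by (simp add: prob_on_def)
  fix F x assume F: "F \<in> FW K cem MO" and x: "x \<in> K"
  have "{w \<in> Om. w \<in> F \<and> site w = x} = F \<inter> at_site x"
    "{w \<in> Om. w \<in> F \<and> x \<in> lift XO w} = F \<inter> hit x"
    using FW_into_Om[OF F] by auto
  moreover have "measure PE (F \<inter> at_site x) = 1 / mean_size * measure W (F \<inter> hit x)"
    using PE(2) F x unfolding site_weights_def by blast
  ultimately show "\<P>(w in PE. w \<in> F \<bar> site w = x) = \<P>(w in W. w \<in> F \<bar> x \<in> lift XO w)"
    using site_weights_at_site[OF PE(2) x] mean_size_pos
    by (simp add: cond_prob_def space space_world)
qed

section \<open>The principles force size bias on a connected graph\<close>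

text \<open>If \<open>hit x\<close> is null, the weight is zero by division by zero, which is consistent: (PEI) with
  the certain event then rules out that the site is \<open>x\<close> with positive probability.\<close>

lemma PEI_imp_site_weights:
  assumes PE: "event_prob PE" and PEI: "PEI K cem MO XO PE"
  shows "site_weights (\<lambda>x. measure PE (at_site x) / measure W (hit x)) PE"
  unfolding site_weights_def
proof (intro ballI)
  interpret PE: prob_space PE using PE by (simp add: prob_on_def)
  have sets: "sets PE = FF K cem MO" and space: "space PE = Om"
    using PE by (simp_all add: prob_on_def)
  fix F x assume F: "F \<in> FW K cem MO" and x: "x \<in> K"
  show "measure PE (F \<inter> at_site x) = measure PE (at_site x) / measure W (hit x) * measure W (F \<inter> hit x)"
  proof (cases "measure PE (at_site x) > 0")
    case True
    have eq: "{w \<in> Om. w \<in> F \<and> site w = x} = F \<inter> at_site x"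
      "{w \<in> Om. w \<in> F \<and> x \<in> lift XO w} = F \<inter> hit x"
      using FW_into_Om[OF F] by auto
    have "\<P>(w in PE. w \<in> F \<bar> site w = x) = \<P>(w in W. w \<in> F \<bar> x \<in> lift XO w)"
      using PEI F x True unfolding PEI_def space by blast
    with True show ?thesis
      by (simp add: cond_prob_def space space_world eq field_simps)
  next
    case False
    then have 0: "measure PE (at_site x) = 0"
      using measure_nonneg[of PE "at_site x"] by linarith
    have "measure PE (F \<inter> at_site x) \<le> measure PE (at_site x)"
      using site_event_in_FF[of K cem MO "{x}"] by (intro PE.finite_measure_mono) (auto simp: sets)
    with 0 show ?thesis by (simp add: measure_le_0_iff)
  qed
qed

text \<open>Fix a value \<open>B\<close> of the random set that contains both ends of the edge and has positive
  probability in the world. The weights give mass \<open>c x\<close> and \<open>c y\<close> times the probability of \<open>B\<close> to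
  the events that \<open>B\<close> occurs and the site is \<open>x\<close> or \<open>y\<close>; (PI) makes these masses equal.\<close>

lemma PI_weights_eq_on_edge:
  assumes PE: "event_prob PE" and PI: "PI K XO PE" and c: "site_weights c PE"
    and edge: "{x, y} \<in> edges K cem MO XO"
  shows "c x = c y"
proof -
  have space: "space PE = Om" using PE by (simp add: prob_on_def)
  from edge obtain a b where ab: "{x, y} = {a, b}" "a \<in> K" "b \<in> K"
    and pos: "measure W {w \<in> Om. {a, b} \<subseteq> lift XO w} > 0"
    by (auto simp: edges_def space_world)
  then have xy: "x \<in> K" "y \<in> K" by (auto simp: doubleton_eq_iff)
  \<comment> \<open>The edge event is a finite union of events fixing the value of the random set.\<close>
  have "\<exists>B. {x, y} \<subseteq> B \<and> B \<subseteq> K \<and> measure W {w \<in> Om. lift XO w = B} > 0"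
  proof (rule ccontr)
    assume no: "\<not> ?thesis"
    let ?\<B> = "{B. {x, y} \<subseteq> B \<and> B \<subseteq> K}"
    have "{w \<in> Om. {a, b} \<subseteq> lift XO w} = (\<Union>B\<in>?\<B>. {w \<in> Om. lift XO w = B})"
      using lift_XO_subset unfolding ab(1)[symmetric] by auto
    moreover have "measure W (\<Union>B\<in>?\<B>. {w \<in> Om. lift XO w = B})
        \<le> (\<Sum>B\<in>?\<B>. measure W {w \<in> Om. lift XO w = B})"
      using XO_event_in_FW[of "\<lambda>C. C = B" for B] finite_K
      by (intro W.finite_measure_subadditive_finite)
         (auto simp: sets_world intro: finite_subset[of _ "Pow K"])
    moreover have "(\<Sum>B\<in>?\<B>. measure W {w \<in> Om. lift XO w = B}) \<le> 0"
      using no by (intro sum_nonpos) (auto simp: not_less)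
    ultimately show False using pos by simp
  qed
  then obtain B where B: "{x, y} \<subseteq> B" "B \<subseteq> K" and q: "measure W {w \<in> Om. lift XO w = B} > 0"
    by blast
  let ?F = "{w \<in> Om. lift XO w = B}"
  have weight: "measure PE (?F \<inter> at_site z) = c z * measure W ?F" if z: "z \<in> {x, y}" for z
  proof -
    have "?F \<inter> hit z = ?F" using z B by auto
    then show ?thesis
      using c XO_event_in_FW[of "\<lambda>C. C = B"] z xy unfolding site_weights_def by fastforce
  qed
  have "measure PE (?F \<inter> at_site x) = measure PE (?F \<inter> at_site y)"
  proof (cases "measure PE ?F > 0")
    case True
    have "measure PE (?F \<inter> at_site z) = measure PE ?F * inverse (real (card B))" if z: "z \<in> {x, y}" for z
    proof -
      have "\<P>(w in PE. site w = z \<bar> lift XO w = B) = inverse (real (card B)) * indicator B z"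
        using PI True B xy z unfolding PI_def space by blast
      moreover have "{w \<in> Om. site w = z \<and> lift XO w = B} = ?F \<inter> at_site z" by auto
      moreover have "z \<in> B" using z B by auto
      ultimately show ?thesis using True by (simp add: cond_prob_def space field_simps)
    qed
    then show ?thesis by simp
  next
    \<comment> \<open>Here (PI) is silent, but both masses vanish, which forces both weights to be zero.\<close>
    case False
    interpret PE: prob_space PE using PE by (simp add: prob_on_def)
    have "?F \<in> sets PE"
      using XO_event_in_FF[of "\<lambda>C. C = B"] PE by (simp add: prob_on_def)
    then have "measure PE (?F \<inter> at_site z) \<le> measure PE ?F" for z
      by (intro PE.finite_measure_mono) auto
    then have "measure PE (?F \<inter> at_site z) = 0" for z
      using False measure_nonneg[of PE "?F \<inter> at_site z"] by (meson not_less order_antisym order_trans)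
    then show ?thesis by simp
  qed
  then show ?thesis using weight q by simp
qed

lemma PN_site_in_K:
  assumes PE: "event_prob PE" and PN: "PN K cem MO XO PE"
  shows "(\<Sum>x\<in>K. measure PE (at_site x)) = 1"
proof -
  interpret PE: prob_space PE using PE by (simp add: prob_on_def)
  have sets: "sets PE = FF K cem MO" and space: "space PE = Om"
    using PE by (simp_all add: prob_on_def)
  have at: "at_site x \<in> sets PE" for x
    using site_event_in_FF[of K cem MO "{x}"] by (simp add: sets)
  have "1 = \<P>(w in PE. site w \<in> lift XO w)" using PN by (simp add: PN_def)
  also have "\<dots> \<le> measure PE (\<Union>x\<in>K. at_site x)"
    using at finite_K lift_XO_subset by (intro PE.finite_measure_mono) (fastforce simp: space)+
  finally have "measure PE (\<Union>x\<in>K. at_site x) = 1"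
    using PE.prob_le_1 by (intro antisym) auto
  moreover have "measure PE (\<Union>x\<in>K. at_site x) = (\<Sum>x\<in>K. measure PE (at_site x))"
    using at finite_K by (intro PE.finite_measure_finite_Union) (auto simp: disjoint_family_on_def)
  ultimately show ?thesis by simp
qed

text \<open>Connectedness propagates equality of the weights from edges to all sites, and (PN) fixes the
  common value by normalisation.\<close>

lemma principles_imp_size_biased:
  assumes conn: "connected_graph K (edges K cem MO XO)"
    and PE: "event_prob PE" and "PN K cem MO XO PE" "PI K XO PE" "PEI K cem MO XO PE"
  shows "size_biased PE"
proof -
  let ?c = "\<lambda>x. measure PE (at_site x) / measure W (hit x)"
  have c: "site_weights ?c PE" by (rule PEI_imp_site_weights[OF PE \<open>PEI K cem MO XO PE\<close>])
  have const: "?c x = ?c y" if "x \<in> K" "y \<in> K" for x y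
  proof -
    have "(x, y) \<in> {(u, v). u \<in> K \<and> v \<in> K \<and> {u, v} \<in> edges K cem MO XO}\<^sup>*"
      using conn that unfolding connected_graph_def by blast
    then show ?thesis
    proof (induction rule: rtrancl_induct)
      case (step y z)
      then have "?c y = ?c z" by (intro PI_weights_eq_on_edge[OF PE \<open>PI K XO PE\<close> c]) auto
      with step.IH show ?case by simp
    qed simp
  qed
  have "?c x = 1 / mean_size" if x: "x \<in> K" for x
  proof -
    have "?c x * mean_size = (\<Sum>y\<in>K. ?c x * measure W (hit y))"
      unfolding mean_size_eq_sum_hit by (rule sum_distrib_left)
    also have "\<dots> = (\<Sum>y\<in>K. measure PE (at_site y))"
    proof (rule sum.cong[OF refl])
      fix y assume y: "y \<in> K"
      show "?c x * measure W (hit y) = measure PE (at_site y)"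
        unfolding const[OF x y] by (rule site_weights_at_site[OF c y, symmetric])
    qed
    also have "\<dots> = 1" by (rule PN_site_in_K[OF PE \<open>PN K cem MO XO PE\<close>])
    finally have total: "?c x * mean_size = 1" .
    show ?thesis
      by (rule eq_divide_imp[OF _ total]) (use mean_size_pos in simp)
  qed
  note weight = this
  show ?thesis
    unfolding site_weights_def
  proof (intro ballI)
    fix F x assume F: "F \<in> FW K cem MO" and x: "x \<in> K"
    show "measure PE (F \<inter> at_site x) = 1 / mean_size * measure W (F \<inter> hit x)"
      using c[unfolded site_weights_def, rule_format, OF F x] unfolding weight[OF x] .
  qed
qed

end

section \<open>Existence, uniqueness and explicit form\<close>

theorem theorem2p3:
  fixes K :: "'k set" and cem :: 'k and MO :: "'o measure" and XO :: "'o \<Rightarrow> 'k set"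
    and P :: "('o \<times> 'k) measure" and lam :: real
  assumes "finite K" and "card K \<ge> 1" and "cem \<notin> K"
    and "prob_space MO"
    and "XO \<in> measurable MO (count_space (Pow K))"
    and "\<P>(\<omega> in MO. XO \<omega> = {}) < 1"
    and P: "P = world K cem MO"
    and lam: "lam = 1 / (\<integral>w. real (card (lift XO w)) \<partial>P)"
  shows
    "(connected_graph K (edges K cem MO XO) \<longrightarrow>
       (\<exists>!PE. prob_on (Omega K cem MO) (FF K cem MO) PE \<and>
          PN K cem MO XO PE \<and> PI K XO PE \<and> PEI K cem MO XO PE) \<and>
       (\<forall>PE. prob_on (Omega K cem MO) (FF K cem MO) PE \<and>
          PN K cem MO XO PE \<and> PI K XO PE \<and> PEI K cem MO XO PE \<longrightarrow>
          (\<forall>F\<in>FW K cem MO. \<forall>x\<in>K.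
             measure PE (F \<inter> {w \<in> space PE. site w = x}) =
             lam * measure P (F \<inter> {w \<in> space P. x \<in> lift XO w})) \<and>
          (\<forall>x\<in>K. \<P>(w in PE. site w = x) = lam * \<P>(w in P. x \<in> lift XO w)) \<and>
          (\<forall>B. B \<subseteq> K \<longrightarrow>
             \<P>(w in PE. lift XO w = B) = lam * real (card B) * \<P>(w in P. lift XO w = B)) \<and>
          (\<forall>F\<in>FW K cem MO.
             measure PE F =
             (\<integral>w. indicator F w * real (card (lift XO w)) \<partial>P) /
             (\<integral>w. real (card (lift XO w)) \<partial>P)))) \<and>
     (\<exists>!PE. prob_on (Omega K cem MO) (FF K cem MO) PE \<and>
        (\<forall>F\<in>FW K cem MO. \<forall>x\<in>K.
           measure PE (F \<inter> {w \<in> space PE. site w = x}) =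
           lam * measure P (F \<inter> {w \<in> space P. x \<in> lift XO w}))) \<and>
     (\<forall>PE. prob_on (Omega K cem MO) (FF K cem MO) PE \<and>
        (\<forall>F\<in>FW K cem MO. \<forall>x\<in>K.
           measure PE (F \<inter> {w \<in> space PE. site w = x}) =
           lam * measure P (F \<inter> {w \<in> space P. x \<in> lift XO w})) \<longrightarrow>
        PN K cem MO XO PE \<and> PI K XO PE \<and> PEI K cem MO XO PE)"
proof -
  interpret observed_random_set MO K cem XO
    using assms by (simp add: observed_random_set_def observed_random_set_axioms_def)
  let ?law = "\<lambda>PE. \<forall>F\<in>FW K cem MO. \<forall>x\<in>K.
    measure PE (F \<inter> {w \<in> space PE. site w = x}) =
    lam * measure P (F \<inter> {w \<in> space P. x \<in> lift XO w})"
  let ?principles = "\<lambda>PE. PN K cem MO XO PE \<and> PI K XO PE \<and> PEI K cem MO XO PE"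
  let ?formulas = "\<lambda>PE. (\<forall>F\<in>FW K cem MO. \<forall>x\<in>K.
    measure PE (F \<inter> {w \<in> space PE. site w = x}) =
    lam * measure P (F \<inter> {w \<in> space P. x \<in> lift XO w})) \<and>
      (\<forall>x\<in>K. \<P>(w in PE. site w = x) = lam * \<P>(w in P. x \<in> lift XO w)) \<and>
      (\<forall>B. B \<subseteq> K \<longrightarrow>
         \<P>(w in PE. lift XO w = B) = lam * real (card B) * \<P>(w in P. lift XO w = B)) \<and>
      (\<forall>F\<in>FW K cem MO.
         measure PE F =
         (\<integral>w. indicator F w * real (card (lift XO w)) \<partial>P) /
         (\<integral>w. real (card (lift XO w)) \<partial>P))"
  have lam': "lam = 1 / mean_size" by (simp add: lam P)
  have law: "?law PE \<longleftrightarrow> size_biased PE" if "event_prob PE" for PE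
    using that unfolding site_weights_def by (simp add: prob_on_def P lam' space_world)
  obtain PS where PS: "event_prob PS" "size_biased PS" using size_biased_exists by blast
  have principles: "?principles PE" if "event_prob PE" "size_biased PE" for PE
    using size_biased_PN[OF that] size_biased_PI[OF that] size_biased_PEI[OF that] by blast
  have a_unique: "\<exists>!PE. event_prob PE \<and> ?principles PE"
    if conn: "connected_graph K (edges K cem MO XO)"
  proof (rule ex1I[of _ PS])
    show "event_prob PS \<and> ?principles PS" using PS(1) principles[OF PS] by (rule conjI)
    fix PE assume "event_prob PE \<and> ?principles PE"
    then have "event_prob PE" "size_biased PE"
      using principles_imp_size_biased[OF conn] by simp_all
    then show "PE = PS" by (rule size_biased_unique[OF _ _ PS])
  qed
  have formulas: "?formulas PE"
    if PE: "event_prob PE" "size_biased PE" for PE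
  proof (intro conjI)
    have space: "space PE = Om" using PE(1) by (simp add: prob_on_def)
    show "?law PE" using PE(2) unfolding law[OF PE(1)] .
    show "\<forall>x\<in>K. \<P>(w in PE. site w = x) = lam * \<P>(w in P. x \<in> lift XO w)"
      unfolding space P space_world lam' using site_weights_at_site[OF PE(2)] by (rule ballI)
    show "\<forall>B. B \<subseteq> K \<longrightarrow>
        \<P>(w in PE. lift XO w = B) = lam * real (card B) * \<P>(w in P. lift XO w = B)"
      unfolding space P space_world lam'
      using size_biased_measure_XO_eq[OF PE] by (intro allI impI)
    show "\<forall>F\<in>FW K cem MO. measure PE F =
        (\<integral>w. indicator F w * real (card (lift XO w)) \<partial>P) / (\<integral>w. real (card (lift XO w)) \<partial>P)"
      unfolding P using size_biased_measure_FW[OF PE] by (rule ballI)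
  qed
  have b_unique: "\<exists>!PE. event_prob PE \<and> ?law PE"
  proof (rule ex1I[of _ PS])
    show "event_prob PS \<and> ?law PS" using PS(1) PS(2)[folded law[OF PS(1)]] by (rule conjI)
    fix PE assume "event_prob PE \<and> ?law PE"
    then have PE: "event_prob PE" and L: "?law PE" by (rule conjunct1, rule conjunct2)
    have "size_biased PE" using L unfolding law[OF PE] .
    with PE show "PE = PS" by (rule size_biased_unique[OF _ _ PS])
  qed
  show ?thesis
  proof (intro conjI[OF impI conjI[OF b_unique]])
    assume conn: "connected_graph K (edges K cem MO XO)"
    show "(\<exists>!PE. event_prob PE \<and> ?principles PE) \<and>
        (\<forall>PE. event_prob PE \<and> ?principles PE \<longrightarrow> ?formulas PE)"
    proof (intro conjI[OF a_unique[OF conn]] allI impI)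
      fix PE assume PE: "event_prob PE \<and> ?principles PE"
      then have "event_prob PE" "size_biased PE"
        using principles_imp_size_biased[OF conn] by simp_all
      then show "?formulas PE" by (rule formulas)
    qed
  next
    show "\<forall>PE. event_prob PE \<and> ?law PE \<longrightarrow> ?principles PE"
    proof (intro allI impI)
      fix PE assume "event_prob PE \<and> ?law PE"
      then have PE: "event_prob PE" and L: "?law PE" by (rule conjunct1, rule conjunct2)
      have "size_biased PE" using L unfolding law[OF PE] .
      with PE show "?principles PE" by (rule principles)
    qed
  qed
qed

end
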